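(* For each integer $N\ge 1$, $$\rho(\mathcal{B}^{N}) = 2^{1/N}-1 .$$ In particular, $\lim_{N\to\infty} N\,\rho(\mathcal{B}^{N}) = \log 2$.
   Context: Here $[N]=\{1,\dots,N\}$ and $\{\pm1\}^N$ carries the normalized counting measure, $\mathbb{E}[f]=2^{-N}\sum_{x\in\{\pm1\}^N}f(x)$. Every $f\colon\{\pm1\}^N\to\mathbb{R}$ has the Fourier-Walsh expansion $f(x)=\sum_{S\subset[N]}\widehat f(S)x^S$, where $x^S=\prod_{k\in S}x_k$ (with $x^\emptyset=1$) and $\widehat f(S)=\mathbb{E}[f(x)\,x^S]$. Put $\|f\|_\infty=\max_{x}|f(x)|$. For a class $\mathcal{F}$ of functions on $\{\pm1\}^N$, its Boolean radius is $$\rho(\mathcal{F})=\sup\Big\{\rho\ge 0:\ \sum_{S\subset[N]}|\widehat f(S)|\rho^{|S|}\le\|f\|_\infty\ \text{for every } f\in\mathcal{F}\Big\}.$$ $\mathcal{B}^N$ denotes the class of all functions $f\colon\{\pm1\}^N\to\mathbb{R}$. $\log$ is the natural logarithm. *)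

theory Defs
  imports Complex_Main "HOL-Library.FuncSet" "HOL-Library.Extended_Real"
begin

text \<open>Points of the cube are extensional functions on the index set, and functions on the
  cube are extensional functions of such points, so that the dimension can be a variable.\<close>

definition cube :: "nat \<Rightarrow> (nat \<Rightarrow> real) set" where
  "cube N = ({1..N} \<rightarrow>\<^sub>E {-1, 1})"

definition cube_expectation :: "nat \<Rightarrow> ((nat \<Rightarrow> real) \<Rightarrow> real) \<Rightarrow> real" where
  "cube_expectation N f = (1 / 2 ^ N) * (\<Sum>x\<in>cube N. f x)"

definition walsh :: "nat set \<Rightarrow> (nat \<Rightarrow> real) \<Rightarrow> real" where
  "walsh S x = (\<Prod>k\<in>S. x k)"

definition fourier_coeff :: "nat \<Rightarrow> ((nat \<Rightarrow> real) \<Rightarrow> real) \<Rightarrow> nat set \<Rightarrow> real" where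
  "fourier_coeff N f S = cube_expectation N (\<lambda>x. f x * walsh S x)"

definition cube_norm :: "nat \<Rightarrow> ((nat \<Rightarrow> real) \<Rightarrow> real) \<Rightarrow> real" where
  "cube_norm N f = Max ((\<lambda>x. \<bar>f x\<bar>) ` cube N)"

text \<open>The supremum is taken in the extended reals, because for some classes
  (for example the constant functions) it is infinite.\<close>

definition boolean_radius :: "nat \<Rightarrow> ((nat \<Rightarrow> real) \<Rightarrow> real) set \<Rightarrow> ereal" where
  "boolean_radius N F =
     Sup {ereal r | r. 0 \<le> r \<and>
       (\<forall>f\<in>F. (\<Sum>S\<in>Pow {1..N}. \<bar>fourier_coeff N f S\<bar> * r ^ card S) \<le> cube_norm N f)}"

definition all_cube_functions :: "nat \<Rightarrow> ((nat \<Rightarrow> real) \<Rightarrow> real) set" where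
  "all_cube_functions N = (cube N \<rightarrow>\<^sub>E UNIV)"

end

theory Submission
  imports Defs "HOL-Real_Asymp.Real_Asymp"
begin

text \<open>
  Both inequalities reduce to the number \<open>(1 + r) ^ N\<close>, which is the sum of \<open>r ^ card S\<close> over all
  \<open>S \<subseteq> {1..N}\<close>.

  For the lower bound on the radius, suppose that \<open>\<bar>f\<bar> \<le> M\<close> on the cube and \<open>S \<noteq> {}\<close>.
  The two numbers \<open>\<E>[f (1 \<plusminus> x\<^sup>S)]\<close> are at most \<open>M\<close> in absolute value, because \<open>1 \<plusminus> x\<^sup>S\<close> is
  nonnegative with mean \<open>1\<close>. Hence the coefficients \<open>a\<close> at the empty set and \<open>b\<close> at \<open>S\<close>
  satisfy \<open>\<bar>a\<bar> + \<bar>b\<bar> \<le> M\<close> (lemma \<open>fourier_coeff_empty_plus_abs_le\<close>). The weighted sum of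
  coefficients is therefore at most \<open>\<bar>a\<bar> + (M - \<bar>a\<bar>) ((1 + r) ^ N - 1)\<close>, which is at most
  \<open>M\<close> as soon as \<open>(1 + r) ^ N \<le> 2\<close>.

  For the upper bound, the function that is \<open>-1\<close> at the point \<open>(1, ..., 1)\<close> and \<open>1\<close> elsewhere
  makes all these estimates sharp: its mean is \<open>1 - 2 / 2 ^ N\<close>, every other coefficient is
  \<open>- 2 / 2 ^ N\<close>, and its weighted sum is \<open>1 + (2 / 2 ^ N) ((1 + r) ^ N - 2)\<close>, which is at most \<open>1\<close>
  exactly when \<open>(1 + r) ^ N \<le> 2\<close> (lemma \<open>coeff_sum_spike\<close>).

  The admissible \<open>r\<close> are thus exactly those with \<open>0 \<le> r \<le> 2 powr (1 / N) - 1\<close>.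
\<close>

section \<open>Expectations on the cube\<close>

lemma finite_cube [simp]: "finite (cube N)"
  by (auto simp: cube_def intro: finite_PiE)

lemma card_cube: "card (cube N) = 2 ^ N"
  by (simp add: cube_def card_PiE numeral_2_eq_2)

lemma all_ones_in_cube: "restrict (\<lambda>_. 1) {1..N} \<in> cube N"
  by (auto simp: cube_def)

lemma cube_nonempty: "cube N \<noteq> {}"
  using all_ones_in_cube by blast

lemma abs_le_cube_norm: "x \<in> cube N \<Longrightarrow> \<bar>f x\<bar> \<le> cube_norm N f"
  unfolding cube_norm_def by (intro Max_ge) auto

lemma cube_expectation_add:
  "cube_expectation N (\<lambda>x. f x + g x) = cube_expectation N f + cube_expectation N g"
  by (simp add: cube_expectation_def sum.distrib algebra_simps add_divide_distrib)

lemma cube_expectation_cmult: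
  "cube_expectation N (\<lambda>x. c * f x) = c * cube_expectation N f"
  by (simp add: cube_expectation_def sum_distrib_left mult.left_commute)

lemma cube_expectation_const: "cube_expectation N (\<lambda>_. c) = c"
  by (simp add: cube_expectation_def card_cube)

lemma abs_cube_expectation_le:
  assumes "\<And>x. x \<in> cube N \<Longrightarrow> \<bar>f x\<bar> \<le> g x"
  shows "\<bar>cube_expectation N f\<bar> \<le> cube_expectation N g"
proof -
  have "\<bar>\<Sum>x\<in>cube N. f x\<bar> \<le> (\<Sum>x\<in>cube N. g x)"
    using assms by (intro order_trans[OF sum_abs] sum_mono)
  then show ?thesis
    by (simp add: cube_expectation_def abs_mult divide_right_mono)
qed

lemma walsh_empty [simp]: "walsh {} x = 1"
  by (simp add: walsh_def)

lemma abs_walsh: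
  assumes "x \<in> cube N" "S \<subseteq> {1..N}"
  shows "\<bar>walsh S x\<bar> = 1"
proof -
  have "\<bar>x k\<bar> = 1" if "k \<in> S" for k
    using assms that by (force simp: cube_def PiE_iff)
  then show ?thesis by (simp add: walsh_def abs_prod)
qed

text \<open>The coordinates are independent with mean \<open>0\<close>, so the sum over the cube factors and every
  coordinate in \<open>S\<close> contributes a factor \<open>-1 + 1\<close>.\<close>
lemma cube_expectation_walsh:
  assumes "S \<subseteq> {1..N}"
  shows "cube_expectation N (walsh S) = (if S = {} then 1 else 0)"
proof (cases "S = {}")
  case True
  then have "walsh S = (\<lambda>_. 1)" by (simp add: fun_eq_iff)
  with True show ?thesis by (simp add: cube_expectation_const)
next
  case False
  let ?g = "\<lambda>k y. if k \<in> S then y else (1::real)"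
  have walsh: "walsh S x = (\<Prod>k\<in>{1..N}. ?g k (x k))" for x
    unfolding walsh_def using assms by (intro prod.mono_neutral_cong_left) auto
  have "(\<Sum>x\<in>cube N. walsh S x) = (\<Prod>k\<in>{1..N}. \<Sum>y\<in>{-1, 1}. ?g k y)"
    unfolding walsh cube_def by (subst prod_sum_PiE) auto
  also have "\<dots> = 0"
    using False assms by auto
  finally show ?thesis using False by (simp add: cube_expectation_def)
qed

section \<open>The lower bound\<close>

text \<open>The pairing of \<open>f\<close> with the nonnegative density \<open>1 + c x\<^sup>S\<close> of mean \<open>1\<close>, where \<open>c = \<plusminus>1\<close>, is an
  average of values of \<open>f\<close>; the sign \<open>c\<close> is chosen so that the two coefficients do not cancel.\<close>
lemma fourier_coeff_empty_plus_abs_le: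
  assumes "S \<subseteq> {1..N}" "S \<noteq> {}"
  shows "\<bar>fourier_coeff N f {}\<bar> + \<bar>fourier_coeff N f S\<bar> \<le> cube_norm N f"
proof -
  let ?M = "cube_norm N f"
  have bound: "\<bar>fourier_coeff N f {} + c * fourier_coeff N f S\<bar> \<le> ?M"
    if c: "\<bar>c\<bar> = 1" for c
  proof -
    have "fourier_coeff N f {} + c * fourier_coeff N f S
        = cube_expectation N (\<lambda>x. f x * (1 + c * walsh S x))"
      unfolding fourier_coeff_def
      by (simp add: cube_expectation_add cube_expectation_cmult [symmetric] algebra_simps)
    also have "\<bar>\<dots>\<bar> \<le> cube_expectation N (\<lambda>x. ?M * (1 + c * walsh S x))"
    proof (rule abs_cube_expectation_le)
      fix x assume x: "x \<in> cube N"
      have "\<bar>c * walsh S x\<bar> = 1"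
        using abs_walsh[OF x assms(1)] c by (simp add: abs_mult)
      then have "0 \<le> 1 + c * walsh S x" by linarith
      then show "\<bar>f x * (1 + c * walsh S x)\<bar> \<le> ?M * (1 + c * walsh S x)"
        using abs_le_cube_norm[OF x, of f] by (simp add: abs_mult mult_right_mono)
    qed
    also have "\<dots> = ?M"
      using assms
      by (simp add: cube_expectation_cmult cube_expectation_add cube_expectation_const
          cube_expectation_walsh)
    finally show ?thesis .
  qed
  from bound[of 1] bound[of "-1"] show ?thesis by simp
qed

lemma sum_Pow_power_card:
  fixes r :: real
  assumes "finite A"
  shows "(\<Sum>S\<in>Pow A. r ^ card S) = (1 + r) ^ card A"
  using prod_add[OF assms, of "\<lambda>_. r" "\<lambda>_. 1"] by (simp add: add.commute)

lemma sum_nonempty_power_card: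
  fixes r :: real
  shows "(\<Sum>S\<in>Pow {1..N} - {{}}. r ^ card S) = (1 + r) ^ N - 1"
  using sum_Pow_power_card[of "{1..N}" r] by (simp add: sum_diff1)

lemma sum_Pow_split_empty:
  fixes h :: "nat set \<Rightarrow> real"
  shows "(\<Sum>S\<in>Pow {1..N}. h S) = h {} + (\<Sum>S\<in>Pow {1..N} - {{}}. h S)"
  by (rule sum.remove) auto

lemma coeff_sum_le_norm:
  assumes r: "0 \<le> r" "(1 + r) ^ N \<le> 2"
  shows "(\<Sum>S\<in>Pow {1..N}. \<bar>fourier_coeff N f S\<bar> * r ^ card S) \<le> cube_norm N f"
proof -
  let ?M = "cube_norm N f" and ?a = "\<bar>fourier_coeff N f {}\<bar>"
  have "?a \<le> cube_expectation N (\<lambda>_. ?M)"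
    unfolding fourier_coeff_def
    by (rule abs_cube_expectation_le) (simp add: abs_le_cube_norm)
  then have a: "?a \<le> ?M" by (simp add: cube_expectation_const)
  have "(\<Sum>S\<in>Pow {1..N} - {{}}. \<bar>fourier_coeff N f S\<bar> * r ^ card S)
      \<le> (\<Sum>S\<in>Pow {1..N} - {{}}. (?M - ?a) * r ^ card S)"
  proof (intro sum_mono mult_right_mono)
    fix S assume "S \<in> Pow {1..N} - {{}}"
    then show "\<bar>fourier_coeff N f S\<bar> \<le> ?M - ?a"
      using fourier_coeff_empty_plus_abs_le[of S N f] by auto
  qed (use r in simp)
  also have "\<dots> = (?M - ?a) * ((1 + r) ^ N - 1)"
    by (simp only: sum_distrib_left [symmetric] sum_nonempty_power_card)
  also have "\<dots> \<le> (?M - ?a) * 1"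
    using a r by (intro mult_left_mono) auto
  finally show ?thesis unfolding sum_Pow_split_empty by simp
qed

section \<open>The extremal function\<close>

text \<open>The function is made extensional, so that it is a member of the class of all functions
  on the cube.\<close>
definition spike :: "nat \<Rightarrow> (nat \<Rightarrow> real) \<Rightarrow> real" where
  "spike N = restrict (\<lambda>x. if x = restrict (\<lambda>_. 1) {1..N} then -1 else 1) (cube N)"

lemma spike_in_all_cube_functions: "spike N \<in> all_cube_functions N"
  by (simp add: spike_def all_cube_functions_def)

lemma cube_norm_spike: "cube_norm N (spike N) = 1"
proof -
  have "(\<lambda>x. \<bar>spike N x\<bar>) ` cube N = (\<lambda>_. 1) ` cube N"
    by (intro image_cong) (auto simp: spike_def)
  then show ?thesis
    using cube_nonempty[of N] by (simp add: cube_norm_def)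
qed

text \<open>The function is \<open>1\<close> minus twice a point mass, and every \<open>x\<^sup>S\<close> equals \<open>1\<close> at the point
  \<open>(1, ..., 1)\<close>.\<close>
lemma fourier_coeff_spike:
  assumes S: "S \<subseteq> {1..N}"
  shows "fourier_coeff N (spike N) S = (if S = {} then 1 else 0) - 2 / 2 ^ N"
proof -
  let ?p = "restrict (\<lambda>_. 1::real) {1..N}"
  have p: "walsh S x = 1" if "x = ?p" for x
    unfolding walsh_def that using S by (intro prod.neutral) auto
  have "(\<Sum>x\<in>cube N. spike N x * walsh S x)
      = (\<Sum>x\<in>cube N. walsh S x - (if x = ?p then 2 else 0))"
    by (rule sum.cong) (auto simp: spike_def p)
  also have "\<dots> = (\<Sum>x\<in>cube N. walsh S x) - 2"
    using all_ones_in_cube[of N] by (simp add: sum_subtractf)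
  finally have "fourier_coeff N (spike N) S = cube_expectation N (walsh S) - 2 / 2 ^ N"
    by (simp add: fourier_coeff_def cube_expectation_def diff_divide_distrib)
  then show ?thesis by (simp add: cube_expectation_walsh[OF S])
qed

lemma coeff_sum_spike:
  assumes "N \<ge> 1"
  shows "(\<Sum>S\<in>Pow {1..N}. \<bar>fourier_coeff N (spike N) S\<bar> * r ^ card S)
    = 1 + 2 / 2 ^ N * ((1 + r) ^ N - 2)"
proof -
  \<comment> \<open>The mean is nonnegative because the cube has at least two points.\<close>
  have "(2::real) ^ 1 \<le> 2 ^ N" using assms by (intro power_increasing) auto
  then have e: "\<bar>fourier_coeff N (spike N) {}\<bar> = 1 - 2 / 2 ^ N"
    by (simp add: fourier_coeff_spike)
  have "(\<Sum>S\<in>Pow {1..N} - {{}}. \<bar>fourier_coeff N (spike N) S\<bar> * r ^ card S)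
      = (\<Sum>S\<in>Pow {1..N} - {{}}. 2 / 2 ^ N * r ^ card S)"
    by (rule sum.cong) (auto simp: fourier_coeff_spike)
  also have "\<dots> = 2 / 2 ^ N * ((1 + r) ^ N - 1)"
    by (simp only: sum_distrib_left [symmetric] sum_nonempty_power_card)
  finally show ?thesis
    unfolding sum_Pow_split_empty by (simp add: e diff_divide_distrib right_diff_distrib)
qed

section \<open>The radius and its asymptotics\<close>

lemma power_le_2_iff:
  fixes r :: real
  assumes "N \<ge> 1" "0 \<le> r"
  shows "(1 + r) ^ N \<le> 2 \<longleftrightarrow> r \<le> 2 powr (1 / real N) - 1"
proof -
  let ?t = "2 powr (1 / real N) :: real"
  have "?t ^ N = 2"
    using assms(1) by (simp add: powr_realpow [symmetric] powr_powr)
  then have "(1 + r) ^ N \<le> 2 \<longleftrightarrow> (1 + r) ^ N \<le> ?t ^ N" by simp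
  also have "\<dots> \<longleftrightarrow> 1 + r \<le> ?t"
    using assms by (intro power_mono_iff) auto
  finally show ?thesis by auto
qed

lemma coeff_sums_le_norm_iff:
  assumes "N \<ge> 1" "0 \<le> r"
  shows "(\<forall>f\<in>all_cube_functions N.
      (\<Sum>S\<in>Pow {1..N}. \<bar>fourier_coeff N f S\<bar> * r ^ card S) \<le> cube_norm N f)
    \<longleftrightarrow> r \<le> 2 powr (1 / real N) - 1" (is "?A \<longleftrightarrow> _")
proof -
  have "?A \<longleftrightarrow> (1 + r) ^ N \<le> 2"
  proof
    assume ?A
    then have "1 + 2 / 2 ^ N * ((1 + r) ^ N - 2) \<le> 1"
      using spike_in_all_cube_functions[of N] coeff_sum_spike[OF assms(1), of r]
        cube_norm_spike[of N] by metis
    then have "2 / 2 ^ N * ((1 + r) ^ N - 2) \<le> 0" by simp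
    moreover have "(0::real) < 2 / 2 ^ N" by simp
    ultimately show "(1 + r) ^ N \<le> 2"
      by (simp only: mult_le_0_iff) linarith
  qed (use coeff_sum_le_norm assms in blast)
  with power_le_2_iff[OF assms] show ?thesis by simp
qed

lemma boolean_radius_all_cube_functions:
  assumes "N \<ge> 1"
  shows "boolean_radius N (all_cube_functions N) = ereal (2 powr (1 / real N) - 1)"
proof -
  let ?t = "2 powr (1 / real N) - 1 :: real"
  have t: "0 \<le> ?t" by (simp add: ge_one_powr_ge_zero)
  have "{ereal r | r. 0 \<le> r \<and> (\<forall>f\<in>all_cube_functions N.
      (\<Sum>S\<in>Pow {1..N}. \<bar>fourier_coeff N f S\<bar> * r ^ card S) \<le> cube_norm N f)}
      = ereal ` {0..?t}"
    using coeff_sums_le_norm_iff[OF assms] by (fastforce simp: image_iff)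
  also have "Sup \<dots> = ereal ?t"
    using t by (intro cSup_eq_maximum) auto
  finally show ?thesis unfolding boolean_radius_def .
qed

theorem theorem2p1:
  "(\<forall>N::nat. N \<ge> 1 \<longrightarrow>
      boolean_radius N (all_cube_functions N) = ereal (2 powr (1 / real N) - 1)) \<and>
   (\<lambda>N::nat. ereal (real N) * boolean_radius N (all_cube_functions N))
      \<longlonglongrightarrow> ereal (ln 2)"
proof (intro conjI allI impI)
  fix N :: nat
  assume "N \<ge> 1"
  then show "boolean_radius N (all_cube_functions N) = ereal (2 powr (1 / real N) - 1)"
    by (rule boolean_radius_all_cube_functions)
next
  have "(\<lambda>N. real N * (2 powr (1 / real N) - 1)) \<longlonglongrightarrow> ln 2"
    by real_asymp
  then have lim: "(\<lambda>N. ereal (real N * (2 powr (1 / real N) - 1))) \<longlonglongrightarrow> ereal (ln 2)"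
    by (rule tendsto_ereal)
  have "\<forall>\<^sub>F N in sequentially. ereal (real N * (2 powr (1 / real N) - 1))
      = ereal (real N) * boolean_radius N (all_cube_functions N)"
    using eventually_ge_at_top[of "1::nat"]
    by eventually_elim (simp add: boolean_radius_all_cube_functions)
  with lim show "(\<lambda>N::nat. ereal (real N) * boolean_radius N (all_cube_functions N))
      \<longlonglongrightarrow> ereal (ln 2)"
    by (rule Lim_transform_eventually)
qed

end
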